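(* Let $\Omega$ be a separable metrisable topological space with Borel $\sigma$-algebra $\mathcal F$, let $\mathcal H\subset C_b$ be a generating vector lattice containing $\mathbf 1_\Omega$, and let $\mathcal C=\mathrm{cl}(\mathcal H)$ be its closure in $L^\Phi(\mathfrak P)$, where $L^\infty(\mathfrak P)\subset L^\Phi(\mathfrak P)$. Suppose that, for every $\varepsilon>0$, there exists a compact set $K\subset\Omega$ with $$\|\mathbf 1_{\Omega\setminus K}\|_{L^\Phi(\mathfrak P)}<\varepsilon.$$ Then $\mathcal C$ is separable.
   Context: $\mathfrak P$ is a nonempty set of probability measures on $(\Omega,\mathcal F)$. $L^0(\mathfrak P)$ is the space of equivalence classes $[f]$ of measurable $f\colon\Omega\to\mathbb R$ under $f\sim g\iff \mathbb P(f=g)=1$ for all $\mathbb P\in\mathfrak P$. $L^\infty(\mathfrak P)\subset L^0(\mathfrak P)$ is the space of classes of bounded random variables. An Orlicz function is a lower semicontinuous, nondecreasing, convex $\phi\colon[0,\infty)\to[0,\infty]$ with $\phi(0)=0$ such that there are $x_0,x_1>0$ with $\phi(x_0)<\infty$, $\phi(x_1)>0$. $\Phi=(\phi_{\mathbb P})_{\mathbb P\in\mathfrak P}$ is a family of Orlicz functions; for $X\in L^0(\mathfrak P)$, $\|X\|_{L^\Phi(\mathfrak P)}=\inf\{\lambda>0:\sup_{\mathbb P\in\mathfrak P}\mathbb E_{\mathbb P}[\phi_{\mathbb P}(\lambda^{-1}|X|)]\le1\}$, and $L^\Phi(\mathfrak P)=\{X: \|X\|_{L^\Phi(\mathfrak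 P)}<\infty\}$, with this norm. Standing assumption: $L^\infty(\mathfrak P)\subset L^\Phi(\mathfrak P)$ (equivalently $\sup_{\mathbb P}\phi_{\mathbb P}(x_0)<\infty$ for some $x_0>0$). $C_b$ is the space of bounded continuous real functions on $\Omega$; functions in $C_b$ are identified with their equivalence classes in $L^\Phi(\mathfrak P)$, so $\mathcal H$ is viewed as a sublattice of $L^\Phi(\mathfrak P)$. $\mathcal H$ is generating if the $\sigma$-algebra generated by $\{f\colon\Omega\to\mathbb R\text{ measurable}:[f]\in\mathcal H\}$ equals $\mathcal F$. *)

theory Defs
  imports "HOL-Analysis.Analysis" "HOL-Probability.Probability"
begin

section \<open>Orlicz functions and the Luxemburg norm\<close>

text \<open>An Orlicz function \<open>[0,\<infinity>) \<rightarrow> [0,\<infinity>]\<close> is encoded as a function \<^typ>\<open>real \<Rightarrow> ennreal\<close> of which only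
  the values on \<^term>\<open>{0..}\<close> matter. Convexity is written out since \<^const>\<open>convex_on\<close> only covers
  real-valued functions; in the degenerate cases the convention \<open>0 \<cdot> \<infinity> = 0\<close> of \<^typ>\<open>ennreal\<close> is
  used.\<close>

definition orlicz_function :: "(real \<Rightarrow> ennreal) \<Rightarrow> bool" where
  "orlicz_function \<phi> \<longleftrightarrow>
     (\<forall>x\<ge>0. \<phi> x \<le> Liminf (at x within {0..}) \<phi>) \<and>
     mono_on {0..} \<phi> \<and>
     (\<forall>x\<ge>0. \<forall>y\<ge>0. \<forall>t\<in>{0..1}.
        \<phi> ((1 - t) * x + t * y) \<le> ennreal (1 - t) * \<phi> x + ennreal t * \<phi> y) \<and>
     \<phi> 0 = 0 \<and>
     (\<exists>x>0. \<phi> x < \<infinity>) \<and> (\<exists>x>0. \<phi> x > 0)"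

definition luxemburg ::
  "'a measure set \<Rightarrow> ('a measure \<Rightarrow> real \<Rightarrow> ennreal) \<Rightarrow> ('a \<Rightarrow> real) \<Rightarrow> ennreal" where
  "luxemburg \<PP> \<Phi> f =
     Inf {ennreal l | l. l > 0 \<and> (SUP P\<in>\<PP>. \<integral>\<^sup>+x. \<Phi> P (\<bar>f x\<bar> / l) \<partial>P) \<le> 1}"


section \<open>Equivalence classes of random variables\<close>

text \<open>Equality is quasi-sure (\<open>qs\<close>): almost sure under every \<open>P \<in> \<PP>\<close>. Classes are sets of
  measurable functions; norm and difference of classes go through an arbitrarily chosen
  representative \<open>qs_rep\<close>, on which they do not depend, see \<open>LPhi_norm_class\<close> and
  \<open>LPhi_dist_class\<close> below. The norm is \<^typ>\<open>ennreal\<close>-valued, so that the infimum over the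
  empty set is \<open>\<infinity>\<close>.\<close>

definition qs_eq :: "'a::topological_space measure set \<Rightarrow> (('a \<Rightarrow> real) \<times> ('a \<Rightarrow> real)) set" where
  "qs_eq \<PP> = {(f, g). f \<in> borel_measurable borel \<and> g \<in> borel_measurable borel \<and>
                      (\<forall>P\<in>\<PP>. AE x in P. f x = g x)}"

definition qs_class ::
  "'a::topological_space measure set \<Rightarrow> ('a \<Rightarrow> real) \<Rightarrow> ('a \<Rightarrow> real) set" where
  "qs_class \<PP> f = qs_eq \<PP> `` {f}"

definition qs_rep :: "('a \<Rightarrow> real) set \<Rightarrow> 'a \<Rightarrow> real" where
  "qs_rep X = (SOME f. f \<in> X)"

definition L0 :: "'a::topological_space measure set \<Rightarrow> ('a \<Rightarrow> real) set set" where
  "L0 \<PP> = borel_measurable borel // qs_eq \<PP>"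

definition Linf :: "'a::topological_space measure set \<Rightarrow> ('a \<Rightarrow> real) set set" where
  "Linf \<PP> = qs_class \<PP> ` {f \<in> borel_measurable borel. bounded (range f)}"

definition qs_diff ::
  "'a::topological_space measure set \<Rightarrow> ('a \<Rightarrow> real) set \<Rightarrow> ('a \<Rightarrow> real) set \<Rightarrow> ('a \<Rightarrow> real) set" where
  "qs_diff \<PP> X Y = qs_class \<PP> (\<lambda>x. qs_rep X x - qs_rep Y x)"

definition LPhi_norm ::
  "'a measure set \<Rightarrow> ('a measure \<Rightarrow> real \<Rightarrow> ennreal) \<Rightarrow> ('a \<Rightarrow> real) set \<Rightarrow> ennreal" where
  "LPhi_norm \<PP> \<Phi> X = luxemburg \<PP> \<Phi> (qs_rep X)"

definition LPhi ::
  "'a::topological_space measure set \<Rightarrow> ('a measure \<Rightarrow> real \<Rightarrow> ennreal) \<Rightarrow> ('a \<Rightarrow> real) set set" where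
  "LPhi \<PP> \<Phi> = {X \<in> L0 \<PP>. LPhi_norm \<PP> \<Phi> X < \<infinity>}"

definition LPhi_dist ::
  "'a::topological_space measure set \<Rightarrow> ('a measure \<Rightarrow> real \<Rightarrow> ennreal) \<Rightarrow>
   ('a \<Rightarrow> real) set \<Rightarrow> ('a \<Rightarrow> real) set \<Rightarrow> real" where
  "LPhi_dist \<PP> \<Phi> X Y = enn2real (LPhi_norm \<PP> \<Phi> (qs_diff \<PP> X Y))"

definition LPhi_topology ::
  "'a::topological_space measure set \<Rightarrow> ('a measure \<Rightarrow> real \<Rightarrow> ennreal) \<Rightarrow>
   ('a \<Rightarrow> real) set topology" where
  "LPhi_topology \<PP> \<Phi> = Metric_space.mtopology (LPhi \<PP> \<Phi>) (LPhi_dist \<PP> \<Phi>)"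


section \<open>Generating vector lattices of functions\<close>

definition vector_lattice :: "('a \<Rightarrow> real) set \<Rightarrow> bool" where
  "vector_lattice H \<longleftrightarrow>
     (\<lambda>x. 0) \<in> H \<and>
     (\<forall>f\<in>H. \<forall>g\<in>H. (\<lambda>x. f x + g x) \<in> H) \<and>
     (\<forall>c. \<forall>f\<in>H. (\<lambda>x. c * f x) \<in> H) \<and>
     (\<forall>f\<in>H. \<forall>g\<in>H. (\<lambda>x. max (f x) (g x)) \<in> H \<and> (\<lambda>x. min (f x) (g x)) \<in> H)"

text \<open>The generated \<open>\<sigma>\<close>-algebra is that of all measurable functions whose class is represented
  in \<open>H\<close>, not only that of the members of \<open>H\<close> themselves.\<close>

definition generating :: "'a::topological_space measure set \<Rightarrow> ('a \<Rightarrow> real) set \<Rightarrow> bool" where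
  "generating \<PP> H \<longleftrightarrow>
     sigma_sets UNIV
       (\<Union>f\<in>{f \<in> borel_measurable borel. qs_class \<PP> f \<in> qs_class \<PP> ` H}.
          {f -` B | B. B \<in> sets borel}) = sets borel"


section \<open>Well-definedness\<close>

lemma equiv_qs_eq: "equiv (borel_measurable borel) (qs_eq \<PP>)"
proof (rule equivI)
  show "qs_eq \<PP> \<subseteq> borel_measurable borel \<times> borel_measurable borel"
    by (auto simp: qs_eq_def)
  show "refl_on (borel_measurable borel) (qs_eq \<PP>)"
    by (auto simp: refl_on_def qs_eq_def)
  show "sym (qs_eq \<PP>)"
    by (auto simp: sym_def qs_eq_def eq_commute)
  show "trans (qs_eq \<PP>)"
    unfolding trans_def qs_eq_def
  proof (clarsimp, goal_cases)
    case (1 f g h P)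
    then have "AE x in P. f x = g x" "AE x in P. g x = h x" by auto
    then show ?case by eventually_elim simp
  qed
qed

lemma qs_class_in_L0: "f \<in> borel_measurable borel \<Longrightarrow> qs_class \<PP> f \<in> L0 \<PP>"
  by (auto simp: L0_def qs_class_def quotientI)

lemma qs_class_eq_iff:
  assumes "f \<in> borel_measurable borel" "g \<in> borel_measurable borel"
  shows "qs_class \<PP> f = qs_class \<PP> g \<longleftrightarrow> (\<forall>P\<in>\<PP>. AE x in P. f x = g x)"
  using eq_equiv_class_iff[OF equiv_qs_eq assms, of \<PP>] assms
  by (auto simp: qs_class_def qs_eq_def)

lemma L0_cases:
  assumes "X \<in> L0 \<PP>"
  shows "qs_rep X \<in> borel_measurable borel" "X = qs_class \<PP> (qs_rep X)"
proof -
  obtain f where f: "f \<in> borel_measurable borel" "X = qs_class \<PP> f"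
    using assms by (auto simp: L0_def qs_class_def elim: quotientE)
  then have "f \<in> X" by (auto simp: qs_class_def qs_eq_def)
  then have "qs_rep X \<in> X" unfolding qs_rep_def by (rule someI[of "\<lambda>f. f \<in> X"])
  then show "qs_rep X \<in> borel_measurable borel" "X = qs_class \<PP> (qs_rep X)"
    using f qs_class_eq_iff[of f "qs_rep X" \<PP>] by (auto simp: qs_class_def qs_eq_def)
qed

lemma qs_rep_AE:
  assumes "f \<in> borel_measurable borel" "P \<in> \<PP>"
  shows "AE x in P. qs_rep (qs_class \<PP> f) x = f x"
  using L0_cases[OF qs_class_in_L0[OF assms(1)], of \<PP>] assms
    qs_class_eq_iff[of "qs_rep (qs_class \<PP> f)" f \<PP>]
  by simp

lemma luxemburg_cong:
  assumes "\<And>P. P \<in> \<PP> \<Longrightarrow> AE x in P. \<bar>f x\<bar> = \<bar>g x\<bar>"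
  shows "luxemburg \<PP> \<Phi> f = luxemburg \<PP> \<Phi> g"
proof -
  have "(\<integral>\<^sup>+x. \<Phi> P (\<bar>f x\<bar> / l) \<partial>P) = (\<integral>\<^sup>+x. \<Phi> P (\<bar>g x\<bar> / l) \<partial>P)" if "P \<in> \<PP>" for P l
    by (rule nn_integral_cong_AE) (use assms[OF that] in \<open>eventually_elim, simp\<close>)
  then show ?thesis by (simp add: luxemburg_def cong: SUP_cong)
qed

lemma LPhi_norm_class:
  assumes "f \<in> borel_measurable borel"
  shows "LPhi_norm \<PP> \<Phi> (qs_class \<PP> f) = luxemburg \<PP> \<Phi> f"
  unfolding LPhi_norm_def
proof (rule luxemburg_cong)
  fix P assume "P \<in> \<PP>"
  from qs_rep_AE[OF assms this] show "AE x in P. \<bar>qs_rep (qs_class \<PP> f) x\<bar> = \<bar>f x\<bar>"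
    by eventually_elim simp
qed

lemma LPhi_dist_class:
  assumes "f \<in> borel_measurable borel" "g \<in> borel_measurable borel"
  shows "LPhi_dist \<PP> \<Phi> (qs_class \<PP> f) (qs_class \<PP> g) = enn2real (luxemburg \<PP> \<Phi> (\<lambda>x. f x - g x))"
proof -
  let ?r = "\<lambda>f. qs_rep (qs_class \<PP> f)"
  have [measurable]: "?r f \<in> borel_measurable borel" "?r g \<in> borel_measurable borel"
    using assms by (auto intro: L0_cases qs_class_in_L0)
  have "LPhi_norm \<PP> \<Phi> (qs_diff \<PP> (qs_class \<PP> f) (qs_class \<PP> g))
      = luxemburg \<PP> \<Phi> (\<lambda>x. ?r f x - ?r g x)"
    unfolding qs_diff_def by (rule LPhi_norm_class) measurable
  also have "\<dots> = luxemburg \<PP> \<Phi> (\<lambda>x. f x - g x)"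
  proof (rule luxemburg_cong)
    fix P assume "P \<in> \<PP>"
    from qs_rep_AE[OF assms(1) this] qs_rep_AE[OF assms(2) this]
    show "AE x in P. \<bar>?r f x - ?r g x\<bar> = \<bar>f x - g x\<bar>" by eventually_elim simp
  qed
  finally show ?thesis by (simp add: LPhi_dist_def)
qed

lemma luxemburg_le:
  assumes "l > 0" "\<And>P. P \<in> \<PP> \<Longrightarrow> (\<integral>\<^sup>+x. \<Phi> P (\<bar>f x\<bar> / l) \<partial>P) \<le> 1"
  shows "luxemburg \<PP> \<Phi> f \<le> ennreal l"
  unfolding luxemburg_def by (rule Inf_lower) (use assms in \<open>auto intro!: SUP_least\<close>)

lemma luxemburg_lessD:
  assumes "\<And>P. P \<in> \<PP> \<Longrightarrow> orlicz_function (\<Phi> P)" "luxemburg \<PP> \<Phi> f < ennreal l"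
  shows "l > 0" "\<And>P. P \<in> \<PP> \<Longrightarrow> (\<integral>\<^sup>+x. \<Phi> P (\<bar>f x\<bar> / l) \<partial>P) \<le> 1"
proof -
  obtain k where k: "k > 0" "ennreal k < ennreal l"
      "(SUP P\<in>\<PP>. \<integral>\<^sup>+x. \<Phi> P (\<bar>f x\<bar> / k) \<partial>P) \<le> 1"
    using assms(2) unfolding luxemburg_def Inf_less_iff by auto
  have kl: "k < l" using k by (simp add: ennreal_less_iff)
  then show "l > 0" using k by simp
  fix P assume P: "P \<in> \<PP>"
  have mono: "mono_on {0..} (\<Phi> P)" using assms(1)[OF P] by (simp add: orlicz_function_def)
  have "(\<integral>\<^sup>+x. \<Phi> P (\<bar>f x\<bar> / l) \<partial>P) \<le> (\<integral>\<^sup>+x. \<Phi> P (\<bar>f x\<bar> / k) \<partial>P)"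
    by (intro nn_integral_mono mono_onD[OF mono] divide_left_mono) (use k kl in auto)
  also have "\<dots> \<le> 1" using k(3) P by (auto simp: SUP_le_iff)
  finally show "(\<integral>\<^sup>+x. \<Phi> P (\<bar>f x\<bar> / l) \<partial>P) \<le> 1" .
qed

lemma orlicz_measurable:
  assumes "orlicz_function \<phi>" "f \<in> borel_measurable M"
  shows "(\<lambda>x. \<phi> \<bar>f x\<bar>) \<in> borel_measurable M"
proof -
  have mono: "mono_on {0..} \<phi>" using assms(1) by (simp add: orlicz_function_def)
  have "mono (\<lambda>x. \<phi> (max 0 x))"
    by (intro monoI mono_onD[OF mono]) auto
  then have "(\<lambda>x. \<phi> (max 0 x)) \<in> borel_measurable borel"
  proof (intro borel_measurableI_ge)
    fix c :: ennreal
    have "is_interval {x. c \<le> \<phi> (max 0 x)}"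
      using \<open>mono _\<close> unfolding is_interval_1 by (blast dest: monoD order_trans)
    then show "{x \<in> space borel. c \<le> \<phi> (max 0 x)} \<in> sets borel"
      by (simp add: real_interval_borel_measurable)
  qed
  then have "(\<lambda>x. \<phi> (max 0 \<bar>f x\<bar>)) \<in> borel_measurable M"
    using assms(2) by measurable
  then show ?thesis by simp
qed

lemma luxemburg_triangle:
  assumes orl: "\<And>P. P \<in> \<PP> \<Longrightarrow> orlicz_function (\<Phi> P)"
    and sets: "\<And>P. P \<in> \<PP> \<Longrightarrow> sets P = sets borel"
    and f: "f \<in> borel_measurable borel" and g: "g \<in> borel_measurable borel"
  shows "luxemburg \<PP> \<Phi> (\<lambda>x. f x + g x) \<le> luxemburg \<PP> \<Phi> f + luxemburg \<PP> \<Phi> g"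
proof (rule ennreal_le_epsilon)
  fix e :: real
  assume fin: "luxemburg \<PP> \<Phi> f + luxemburg \<PP> \<Phi> g < top" and e: "e > 0"
  have fin': "luxemburg \<PP> \<Phi> f < top" "luxemburg \<PP> \<Phi> g < top"
    using fin by (auto simp: less_top[symmetric])
  define a where "a = enn2real (luxemburg \<PP> \<Phi> f) + e / 2"
  define b where "b = enn2real (luxemburg \<PP> \<Phi> g) + e / 2"
  have lf: "luxemburg \<PP> \<Phi> f = ennreal (enn2real (luxemburg \<PP> \<Phi> f))"
    and lg: "luxemburg \<PP> \<Phi> g = ennreal (enn2real (luxemburg \<PP> \<Phi> g))" using fin' by simp_all
  have "luxemburg \<PP> \<Phi> f < ennreal a" "luxemburg \<PP> \<Phi> g < ennreal b"
    using e by (subst lf, simp add: a_def ennreal_less_iff, subst lg, simp add: b_def ennreal_less_iff)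
  from luxemburg_lessD[OF orl this(1)] luxemburg_lessD[OF orl this(2)]
  have a: "a > 0" "\<And>P. P \<in> \<PP> \<Longrightarrow> (\<integral>\<^sup>+x. \<Phi> P (\<bar>f x\<bar> / a) \<partial>P) \<le> 1"
    and b: "b > 0" "\<And>P. P \<in> \<PP> \<Longrightarrow> (\<integral>\<^sup>+x. \<Phi> P (\<bar>g x\<bar> / b) \<partial>P) \<le> 1" by auto
  define t where "t = b / (a + b)"
  have t: "t \<in> {0..1}" "1 - t = a / (a + b)" using a b by (auto simp: t_def field_simps)
  have "luxemburg \<PP> \<Phi> (\<lambda>x. f x + g x) \<le> ennreal (a + b)"
  proof (rule luxemburg_le)
    show "a + b > 0" using a b by simp
    fix P assume P: "P \<in> \<PP>"
    have [measurable]: "f \<in> borel_measurable P" "g \<in> borel_measurable P"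
      using f g sets[OF P] by (simp_all cong: measurable_cong_sets)
    have mf: "(\<lambda>x. \<Phi> P (\<bar>f x\<bar> / a)) \<in> borel_measurable P"
      using orlicz_measurable[OF orl[OF P], of "\<lambda>x. f x / a" P] a by (simp add: abs_divide)
    have mg: "(\<lambda>x. \<Phi> P (\<bar>g x\<bar> / b)) \<in> borel_measurable P"
      using orlicz_measurable[OF orl[OF P], of "\<lambda>x. g x / b" P] b by (simp add: abs_divide)
    have pt: "\<Phi> P (\<bar>f x + g x\<bar> / (a + b))
        \<le> ennreal (1 - t) * \<Phi> P (\<bar>f x\<bar> / a) + ennreal t * \<Phi> P (\<bar>g x\<bar> / b)" for x
    proof -
      have "(1 - t) * (\<bar>f x\<bar> / a) + t * (\<bar>g x\<bar> / b) = (\<bar>f x\<bar> + \<bar>g x\<bar>) / (a + b)"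
        unfolding t(2) using a b by (simp add: t_def add_divide_distrib)
      then have "\<bar>f x + g x\<bar> / (a + b) \<le> (1 - t) * (\<bar>f x\<bar> / a) + t * (\<bar>g x\<bar> / b)"
        using a b by (simp add: divide_right_mono)
      moreover have "mono_on {0..} (\<Phi> P)" using orl[OF P] by (simp add: orlicz_function_def)
      ultimately have "\<Phi> P (\<bar>f x + g x\<bar> / (a + b)) \<le> \<Phi> P ((1 - t) * (\<bar>f x\<bar> / a) + t * (\<bar>g x\<bar> / b))"
        using a b t by (intro mono_onD[of "{0..}" "\<Phi> P"]) auto
      also have "\<dots> \<le> ennreal (1 - t) * \<Phi> P (\<bar>f x\<bar> / a) + ennreal t * \<Phi> P (\<bar>g x\<bar> / b)"
      proof -
        have "\<forall>x\<ge>0. \<forall>y\<ge>0. \<Phi> P ((1 - t) * x + t * y) \<le> ennreal (1 - t) * \<Phi> P x + ennreal t * \<Phi> P y"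
          using orl[OF P] t(1) unfolding orlicz_function_def by blast
        then show ?thesis using a(1) b(1) by (metis abs_ge_zero divide_nonneg_pos)
      qed
      finally show ?thesis .
    qed
    have "(\<integral>\<^sup>+x. \<Phi> P (\<bar>f x + g x\<bar> / (a + b)) \<partial>P)
        \<le> (\<integral>\<^sup>+x. ennreal (1 - t) * \<Phi> P (\<bar>f x\<bar> / a) + ennreal t * \<Phi> P (\<bar>g x\<bar> / b) \<partial>P)"
      by (intro nn_integral_mono pt)
    also have "\<dots> = ennreal (1 - t) * (\<integral>\<^sup>+x. \<Phi> P (\<bar>f x\<bar> / a) \<partial>P)
        + ennreal t * (\<integral>\<^sup>+x. \<Phi> P (\<bar>g x\<bar> / b) \<partial>P)"
      using mf mg by (simp add: nn_integral_add nn_integral_cmult)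
    also have "\<dots> \<le> ennreal (1 - t) * 1 + ennreal t * 1"
      by (intro add_mono mult_left_mono a b P) auto
    also have "\<dots> = 1" using t(1) by (simp flip: ennreal_plus)
    finally show "(\<integral>\<^sup>+x. \<Phi> P (\<bar>f x + g x\<bar> / (a + b)) \<partial>P) \<le> 1" .
  qed
  also have "a + b = enn2real (luxemburg \<PP> \<Phi> f) + enn2real (luxemburg \<PP> \<Phi> g) + e"
    by (simp add: a_def b_def)
  also have "ennreal \<dots> = luxemburg \<PP> \<Phi> f + luxemburg \<PP> \<Phi> g + ennreal e"
    using e fin' by (simp add: ennreal_plus)
  finally show "luxemburg \<PP> \<Phi> (\<lambda>x. f x + g x)
      \<le> luxemburg \<PP> \<Phi> f + luxemburg \<PP> \<Phi> g + ennreal e" .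
qed

lemma orlicz_scale:
  assumes "orlicz_function \<phi>" "x \<ge> 0" "n \<ge> 1"
  shows "ennreal n * \<phi> x \<le> \<phi> (n * x)"
proof -
  have "\<phi> ((1 - 1 / n) * 0 + 1 / n * (n * x))
      \<le> ennreal (1 - 1 / n) * \<phi> 0 + ennreal (1 / n) * \<phi> (n * x)"
  proof -
    have "\<forall>u\<ge>0. \<forall>v\<ge>0. \<forall>t\<in>{0..1}. \<phi> ((1 - t) * u + t * v) \<le> ennreal (1 - t) * \<phi> u + ennreal t * \<phi> v"
      using assms(1) unfolding orlicz_function_def by blast
    from this[rule_format, of 0 "n * x" "1 / n"] show ?thesis using assms(2,3) by simp
  qed
  then have "\<phi> x \<le> ennreal (1 / n) * \<phi> (n * x)"
    using assms by (simp add: orlicz_function_def)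
  then have "ennreal n * \<phi> x \<le> ennreal n * (ennreal (1 / n) * \<phi> (n * x))"
    by (rule mult_left_mono) simp
  also have "\<dots> = \<phi> (n * x)"
    using assms by (simp add: mult.assoc[symmetric] flip: ennreal_mult)
  finally show ?thesis .
qed

lemma luxemburg_eq_0_iff:
  assumes orl: "\<And>P. P \<in> \<PP> \<Longrightarrow> orlicz_function (\<Phi> P)"
    and sets: "\<And>P. P \<in> \<PP> \<Longrightarrow> sets P = sets borel"
    and f: "f \<in> borel_measurable borel"
  shows "luxemburg \<PP> \<Phi> f = 0 \<longleftrightarrow> (\<forall>P\<in>\<PP>. AE x in P. f x = 0)"
proof
  assume z: "luxemburg \<PP> \<Phi> f = 0"
  show "\<forall>P\<in>\<PP>. AE x in P. f x = 0"
  proof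
    fix P assume P: "P \<in> \<PP>"
    have [measurable]: "f \<in> borel_measurable P"
      using f sets[OF P] by (simp cong: measurable_cong_sets)
    obtain y where y: "y > 0" "\<Phi> P y > 0" using orl[OF P] by (auto simp: orlicz_function_def)
    have mono: "mono_on {0..} (\<Phi> P)" using orl[OF P] by (simp add: orlicz_function_def)
    have "emeasure P {x \<in> space P. \<bar>f x\<bar> \<ge> d} = 0" if d: "d > 0" for d
    proof (rule ccontr)
      let ?A = "{x \<in> space P. \<bar>f x\<bar> \<ge> d}"
      assume nz: "emeasure P ?A \<noteq> 0"
      have bound: "ennreal (real n) * (\<Phi> P y * emeasure P ?A) \<le> 1" if n: "n \<ge> 1" for n :: nat
      proof -
        define l where "l = d / (real n * y)"
        have l: "l > 0" "d / l = real n * y" using d n y by (auto simp: l_def)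
        have "ennreal (real n) * (\<Phi> P y * emeasure P ?A)
            = (ennreal (real n) * \<Phi> P y) * emeasure P ?A" by (simp add: mult.assoc)
        also have "\<dots> \<le> \<Phi> P (real n * y) * emeasure P ?A"
          by (intro mult_right_mono orlicz_scale[OF orl[OF P]]) (use y n in auto)
        also have "\<dots> = (\<integral>\<^sup>+x. \<Phi> P (real n * y) * indicator ?A x \<partial>P)"
          by (subst nn_integral_cmult_indicator) auto
        also have "\<dots> \<le> (\<integral>\<^sup>+x. \<Phi> P (\<bar>f x\<bar> / l) \<partial>P)"
        proof (rule nn_integral_mono)
          fix x
          have "\<Phi> P (d / l) \<le> \<Phi> P (\<bar>f x\<bar> / l)" if "x \<in> ?A"
            by (intro mono_onD[OF mono] divide_right_mono) (use that d l(1) in auto)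
          then show "\<Phi> P (real n * y) * indicator ?A x \<le> \<Phi> P (\<bar>f x\<bar> / l)"
            unfolding l(2) by (cases "x \<in> ?A") auto
        qed
        also have "\<dots> \<le> 1"
          by (rule luxemburg_lessD(2)[OF orl _ P]) (use z l in auto)
        finally show ?thesis .
      qed
      have "\<Phi> P y * emeasure P ?A > 0" (is "?c > 0")
        using y nz by (simp add: ennreal_zero_less_mult_iff zero_less_iff_neq_zero)
      then obtain c where c: "0 < c" "ennreal c \<le> ?c"
        by (cases "\<Phi> P y * emeasure P ?A") (use that[of 1] that in auto)
      obtain n :: nat where n: "real n * c > 1" using reals_Archimedean3[OF c(1)] by blast
      then have "n \<ge> 1" by (cases n) auto
      have "ennreal (real n * c) \<le> ennreal (real n) * ?c"
        using c by (simp add: ennreal_mult mult_left_mono)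
      also have "\<dots> \<le> 1" by (rule bound) fact
      finally show False using n by simp
    qed
    then have "AE x in P. \<not> \<bar>f x\<bar> \<ge> 1 / real (Suc k)" for k
      by (subst AE_iff_measurable[OF _ refl]) auto
    then have "AE x in P. \<forall>k. \<not> \<bar>f x\<bar> \<ge> 1 / real (Suc k)"
      unfolding AE_all_countable by (rule allI)
    then show "AE x in P. f x = 0"
    proof eventually_elim
      case (elim x)
      show ?case
      proof (rule ccontr)
        assume "f x \<noteq> 0"
        then obtain k where "inverse (real (Suc k)) < \<bar>f x\<bar>"
          using reals_Archimedean[of "\<bar>f x\<bar>"] by auto
        with elim show False by (auto simp: inverse_eq_divide dest!: spec[of _ k])
      qed
    qed
  qed
next
  assume *: "\<forall>P\<in>\<PP>. AE x in P. f x = 0"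
  have "luxemburg \<PP> \<Phi> f = luxemburg \<PP> \<Phi> (\<lambda>x. 0)"
    by (rule luxemburg_cong) (use * in auto)
  also have "\<dots> \<le> 0"
  proof (rule ennreal_le_epsilon)
    fix e :: real assume "e > 0"
    then show "luxemburg \<PP> \<Phi> (\<lambda>x. 0) \<le> 0 + ennreal e"
      using orl by (auto intro!: luxemburg_le simp: orlicz_function_def)
  qed
  finally show "luxemburg \<PP> \<Phi> f = 0" by simp
qed

lemma luxemburg_minus_commute:
  "luxemburg \<PP> \<Phi> (\<lambda>x. f x - g x) = luxemburg \<PP> \<Phi> (\<lambda>x. g x - f x)"
  by (simp add: luxemburg_def abs_minus_commute)

text \<open>In particular \<^const>\<open>LPhi_topology\<close> is the topology of a genuine metric.\<close>

lemma Metric_space_LPhi: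
  assumes orl: "\<And>P. P \<in> \<PP> \<Longrightarrow> orlicz_function (\<Phi> P)"
    and sets: "\<And>P. P \<in> \<PP> \<Longrightarrow> sets P = sets borel"
  shows "Metric_space (LPhi \<PP> \<Phi>) (LPhi_dist \<PP> \<Phi>)"
proof -
  have rep: "qs_rep X \<in> borel_measurable borel" "X = qs_class \<PP> (qs_rep X)"
    "luxemburg \<PP> \<Phi> (qs_rep X) < \<infinity>" if "X \<in> LPhi \<PP> \<Phi>" for X
    using that L0_cases[of X \<PP>] by (auto simp: LPhi_def LPhi_norm_def)
  have dist: "LPhi_dist \<PP> \<Phi> X Y = enn2real (luxemburg \<PP> \<Phi> (\<lambda>x. qs_rep X x - qs_rep Y x))"
    if "X \<in> LPhi \<PP> \<Phi>" "Y \<in> LPhi \<PP> \<Phi>" for X Y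
    using LPhi_dist_class[of "qs_rep X" "qs_rep Y" \<PP> \<Phi>] rep[OF that(1)] rep[OF that(2)] by simp
  have fin: "luxemburg \<PP> \<Phi> (\<lambda>x. qs_rep X x - qs_rep Y x) < \<infinity>"
    if X: "X \<in> LPhi \<PP> \<Phi>" and Y: "Y \<in> LPhi \<PP> \<Phi>" for X Y
  proof -
    have "luxemburg \<PP> \<Phi> (\<lambda>x. qs_rep X x + - qs_rep Y x)
        \<le> luxemburg \<PP> \<Phi> (qs_rep X) + luxemburg \<PP> \<Phi> (\<lambda>x. - qs_rep Y x)"
      by (rule luxemburg_triangle[OF orl sets]) (use rep[OF X] rep[OF Y] in auto)
    also have "luxemburg \<PP> \<Phi> (\<lambda>x. - qs_rep Y x) = luxemburg \<PP> \<Phi> (qs_rep Y)"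
      by (rule luxemburg_cong) simp
    also have "luxemburg \<PP> \<Phi> (qs_rep X) + luxemburg \<PP> \<Phi> (qs_rep Y) < \<infinity>"
      using rep(3)[OF X] rep(3)[OF Y] by simp
    finally show ?thesis by simp
  qed
  show ?thesis
  proof
    fix X Y
    show "0 \<le> LPhi_dist \<PP> \<Phi> X Y" by (simp add: LPhi_dist_def)
  next
    fix X Y
    have "luxemburg \<PP> \<Phi> (qs_rep (qs_class \<PP> (\<lambda>x. qs_rep X x - qs_rep Y x)))
        = luxemburg \<PP> \<Phi> (qs_rep (qs_class \<PP> (\<lambda>x. qs_rep Y x - qs_rep X x)))"
    proof (cases "(\<lambda>x. qs_rep X x - qs_rep Y x) \<in> borel_measurable borel")
      case True
      then have "(\<lambda>x. - (qs_rep X x - qs_rep Y x)) \<in> borel_measurable borel" by measurable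
      then have "(\<lambda>x. qs_rep Y x - qs_rep X x) \<in> borel_measurable borel" by simp
      with True show ?thesis
        using luxemburg_minus_commute LPhi_norm_class unfolding LPhi_norm_def by metis
    next
      case False
      have "(\<lambda>x. qs_rep Y x - qs_rep X x) \<notin> borel_measurable borel"
      proof
        assume "(\<lambda>x. qs_rep Y x - qs_rep X x) \<in> borel_measurable borel"
        then have "(\<lambda>x. - (qs_rep Y x - qs_rep X x)) \<in> borel_measurable borel" by measurable
        with False show False by simp
      qed
      with False have "qs_class \<PP> (\<lambda>x. qs_rep X x - qs_rep Y x)
          = qs_class \<PP> (\<lambda>x. qs_rep Y x - qs_rep X x)"
        by (auto simp: qs_class_def qs_eq_def)
      then show ?thesis by simp
    qed
    then show "LPhi_dist \<PP> \<Phi> X Y = LPhi_dist \<PP> \<Phi> Y X"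
      by (simp add: LPhi_dist_def LPhi_norm_def qs_diff_def)
  next
    fix X Y assume X: "X \<in> LPhi \<PP> \<Phi>" and Y: "Y \<in> LPhi \<PP> \<Phi>"
    have "LPhi_dist \<PP> \<Phi> X Y = 0 \<longleftrightarrow> luxemburg \<PP> \<Phi> (\<lambda>x. qs_rep X x - qs_rep Y x) = 0"
      using fin[OF X Y] by (auto simp: dist[OF X Y] enn2real_eq_0_iff)
    also have "\<dots> \<longleftrightarrow> (\<forall>P\<in>\<PP>. AE x in P. qs_rep X x - qs_rep Y x = 0)"
      by (rule luxemburg_eq_0_iff[OF orl sets]) (use rep[OF X] rep[OF Y] in auto)
    also have "\<dots> \<longleftrightarrow> X = Y"
      using qs_class_eq_iff[OF rep(1)[OF X] rep(1)[OF Y], of \<PP>] rep(2)[OF X] rep(2)[OF Y] by simp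
    finally show "LPhi_dist \<PP> \<Phi> X Y = 0 \<longleftrightarrow> X = Y" .
  next
    fix X Y Z assume X: "X \<in> LPhi \<PP> \<Phi>" and Y: "Y \<in> LPhi \<PP> \<Phi>" and Z: "Z \<in> LPhi \<PP> \<Phi>"
    let ?d = "\<lambda>X Y. luxemburg \<PP> \<Phi> (\<lambda>x. qs_rep X x - qs_rep Y x)"
    have "?d X Z = luxemburg \<PP> \<Phi> (\<lambda>x. (qs_rep X x - qs_rep Y x) + (qs_rep Y x - qs_rep Z x))"
      by simp
    also have "\<dots> \<le> ?d X Y + ?d Y Z"
      by (rule luxemburg_triangle[OF orl sets]) (use rep[OF X] rep[OF Y] rep[OF Z] in auto)
    finally have "enn2real (?d X Z) \<le> enn2real (?d X Y + ?d Y Z)"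
      using fin[OF X Y] fin[OF Y Z] by (intro enn2real_mono) auto
    also have "\<dots> = enn2real (?d X Y) + enn2real (?d Y Z)"
      using fin[OF X Y] fin[OF Y Z] by (intro enn2real_plus) auto
    finally show "LPhi_dist \<PP> \<Phi> X Z \<le> LPhi_dist \<PP> \<Phi> X Y + LPhi_dist \<PP> \<Phi> Y Z"
      by (simp add: dist X Y Z)
  qed
qed

end

theory Submission
  imports Defs
begin

text \<open>
  If \<open>\<bar>f\<bar>, \<bar>g\<bar> \<le> n\<close> and \<open>\<bar>f - g\<bar> < \<delta>\<close> on \<open>K\<close>, then \<open>\<bar>f - g\<bar> \<le> \<delta> + 2n 1\<^bsub>\<Omega>\<setminus>K\<^esub>\<close>, so the norm of
  \<open>f - g\<close> is at most \<open>\<delta> \<parallel>1\<parallel> + 2n \<parallel>1\<^bsub>\<Omega>\<setminus>K\<^esub>\<parallel>\<close>, which is small for small \<open>\<delta>\<close> and a suitable compact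
  set \<open>K\<close> depending on \<open>n\<close>. As \<open>C(K)\<close> is separable for the uniform norm, the elements of \<open>H\<close>
  bounded by \<open>n\<close> have countable nets of arbitrary fineness in the Luxemburg norm; their union over
  all \<open>n\<close> is dense in \<open>H\<close>, hence in its closure.
\<close>

text \<open>The balls of radius \<open>1/(n+1)\<close> about a countable dense set form a base:
  inside \<open>mball x r\<close>, take a radius \<open>e < r / 2\<close> and a dense point
  \<open>y\<close> within \<open>e\<close> of \<open>x\<close>; then \<open>mball y e\<close>
  contains \<open>x\<close> and stays in \<open>mball x r\<close>.\<close>

lemma separable_metrizable_imp_second_countable:
  assumes "metrizable_space X" "separable_space X"
  shows "second_countable X"
proof -
  obtain M d where Md: "Metric_space M d" and X: "X = Metric_space.mtopology M d"
    using assms(1) unfolding metrizable_space_def by blast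
  interpret Metric_space M d by (rule Md)
  obtain D where D: "countable D" "D \<subseteq> M" "mtopology closure_of D = M"
    using assms(2) unfolding separable_space_def X by auto
  define \<B> where "\<B> = (\<lambda>(y, n). mball y (inverse (real (Suc n)))) ` (D \<times> UNIV)"
  have "\<exists>V\<in>\<B>. x \<in> V \<and> V \<subseteq> U" if U: "openin mtopology U" "x \<in> U" for U x
  proof -
    obtain r where r: "r > 0" "mball x r \<subseteq> U"
      using U unfolding openin_mtopology by blast
    obtain n where n: "inverse (real (Suc n)) < r / 2"
      using reals_Archimedean[of "r / 2"] r by auto
    define e where "e = inverse (real (Suc n))"
    have e: "e > 0" "e < r / 2" using n by (simp_all add: e_def)
    have "x \<in> mtopology closure_of D"
      using U D(3) openin_subset by fastforce
    then obtain y where y: "y \<in> D" "y \<in> mball x e"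
      using e(1) unfolding metric_closure_of by blast
    have "mball y e \<subseteq> mball x r"
    proof
      fix z assume z: "z \<in> mball y e"
      then have "d x z \<le> d x y + d y z" using y by (intro triangle) auto
      also have "\<dots> < r" using y z e by auto
      finally show "z \<in> mball x r" using y z by auto
    qed
    moreover have "x \<in> mball y e" using y by (auto simp: commute)
    moreover have "mball y e \<in> \<B>"
      unfolding \<B>_def e_def using y(1) by (intro image_eqI[of _ _ "(y, n)"]) auto
    ultimately show ?thesis using r(2) by blast
  qed
  moreover have "countable \<B>" unfolding \<B>_def using D(1) by auto
  moreover have "\<forall>V\<in>\<B>. openin mtopology V" unfolding \<B>_def by auto
  ultimately show ?thesis unfolding second_countable_def X by blast
qed

text \<open>A function continuous on \<open>K\<close> is determined up to \<open>\<delta>\<close> by finitely many pairs of a basic open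
  set \<open>U\<close> and a point \<open>q\<close> of a countable dense set such that the function is \<open>\<delta> / 2\<close>-close to \<open>q\<close>
  on \<open>U\<close>; there are only countably many such finite data.\<close>

lemma countable_uniform_net:
  fixes F :: "('a::topological_space \<Rightarrow> 'b::{metric_space, second_countable_topology}) set"
  assumes sc: "second_countable (euclidean :: 'a topology)"
    and K: "compact K" and cont: "\<And>f. f \<in> F \<Longrightarrow> continuous_on K f" and \<delta>: "\<delta> > 0"
  obtains D where "D \<subseteq> F" "countable D" "\<And>f. f \<in> F \<Longrightarrow> \<exists>g\<in>D. \<forall>x\<in>K. dist (f x) (g x) < \<delta>"
proof -
  obtain \<B> :: "'a set set" where \<B>: "countable \<B>" "\<And>V. V \<in> \<B> \<Longrightarrow> open V"
      "\<And>U x. open U \<Longrightarrow> x \<in> U \<Longrightarrow> \<exists>V\<in>\<B>. x \<in> V \<and> V \<subseteq> U"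
    using sc unfolding second_countable_def by auto
  obtain Q :: "'b set" where Q: "countable Q" "\<And>X. open X \<Longrightarrow> X \<noteq> {} \<Longrightarrow> \<exists>q\<in>Q. q \<in> X"
    by (metis countable_dense_setE)
  define R where "R f S \<longleftrightarrow> f \<in> F \<and> K \<subseteq> (\<Union>p\<in>S. fst p) \<and>
      (\<forall>p\<in>S. \<forall>x\<in>fst p \<inter> K. dist (f x) (snd p) < \<delta> / 2)"
    for f and S :: "('a set \<times> 'b) set"
  define \<S> where "\<S> = {S. finite S \<and> S \<subseteq> \<B> \<times> Q \<and> (\<exists>f. R f S)}"
  have ex: "\<exists>S\<in>\<S>. R f S" if f: "f \<in> F" for f
  proof -
    define G where "G = {(U, q) \<in> \<B> \<times> Q. \<forall>x\<in>U \<inter> K. dist (f x) q < \<delta> / 2}"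
    have "K \<subseteq> (\<Union>p\<in>G. fst p)"
    proof
      fix x assume x: "x \<in> K"
      obtain q where q: "q \<in> Q" "q \<in> ball (f x) (\<delta> / 2)"
        using Q(2)[of "ball (f x) (\<delta> / 2)"] \<delta> by auto
      \<comment> \<open>Continuity on \<open>K\<close> only makes the preimage relatively open;
        \<open>A\<close> is open in the whole space with the same trace on \<open>K\<close>, so a
        basic set fits inside it. The ball is centred at \<open>q\<close>, which gives the condition
        in \<open>G\<close> directly.\<close>
      obtain A where A: "open A" "A \<inter> K = f -` ball q (\<delta> / 2) \<inter> K"
        using cont[OF f] unfolding continuous_on_open_invariant by (meson open_ball)
      have "x \<in> A" using A(2) x q by (auto simp: dist_commute)
      then obtain U where U: "U \<in> \<B>" "x \<in> U" "U \<subseteq> A" using \<B>(3) A(1) by blast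
      have "(U, q) \<in> G" using U A(2) q unfolding G_def by (auto simp: dist_commute)
      then show "x \<in> (\<Union>p\<in>G. fst p)" using U by force
    qed
    moreover have "\<And>p. p \<in> G \<Longrightarrow> open (fst p)" using \<B>(2) by (auto simp: G_def)
    ultimately obtain S where "S \<subseteq> G" "finite S" "K \<subseteq> (\<Union>p\<in>S. fst p)"
      using compactE_image[OF K, of G fst] by metis
    then have "R f S" "S \<subseteq> \<B> \<times> Q" unfolding R_def G_def using f by (fastforce simp: case_prod_beta)+
    then show ?thesis unfolding \<S>_def using \<open>finite S\<close> by blast
  qed
  \<comment> \<open>Functions with the same data \<open>S\<close> are \<open>\<delta>\<close>-close
    on \<open>K\<close> through the common values \<open>snd p\<close>, so any choice serves.
    \<open>R\<close> demands membership in \<open>F\<close>, which keeps the net inside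
    \<open>F\<close>.\<close>
  define c where "c S = (SOME f. R f S)" for S
  have c: "R (c S) S" if "S \<in> \<S>" for S
    using that someI_ex[of "\<lambda>f. R f S"] unfolding \<S>_def c_def by blast
  have "countable \<S>"
  proof (rule countable_subset)
    show "\<S> \<subseteq> {S. finite S \<and> S \<subseteq> \<B> \<times> Q}" by (auto simp: \<S>_def)
    show "countable {S. finite S \<and> S \<subseteq> \<B> \<times> Q}"
      using countable_Collect_finite_subset[of "\<B> \<times> Q"] \<B>(1) Q(1) by auto
  qed
  show ?thesis
  proof
    show "c ` \<S> \<subseteq> F" using c by (auto simp: R_def)
    show "countable (c ` \<S>)" using \<open>countable \<S>\<close> by auto
    fix f assume "f \<in> F"
    then obtain S where S: "S \<in> \<S>" "R f S" using ex by blast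
    have "dist (f x) (c S x) < \<delta>" if x: "x \<in> K" for x
    proof -
      obtain p where "p \<in> S" "x \<in> fst p" using S(2) x unfolding R_def by blast
      then have "dist (f x) (snd p) < \<delta> / 2" "dist (c S x) (snd p) < \<delta> / 2"
        using S c[OF S(1)] x unfolding R_def by blast+
      then show ?thesis by (rule dist_triangle_half_l)
    qed
    then show "\<exists>g\<in>c ` \<S>. \<forall>x\<in>K. dist (f x) (g x) < \<delta>" using S(1) by blast
  qed
qed

text \<open>The union of nets of fineness \<open>1/(n+1)\<close> is countable and its closure
  contains \<open>A\<close>. Being closed, that closure also contains the closure of
  \<open>A\<close>, and the nets lie in \<open>A\<close>, so they are dense in the subspace.\<close>

lemma (in Metric_space) separable_space_closure_of:
  assumes A: "A \<subseteq> M"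
    and net: "\<And>\<epsilon>. \<epsilon> > 0 \<Longrightarrow> \<exists>D\<subseteq>A. countable D \<and> (\<forall>x\<in>A. \<exists>y\<in>D. d x y < \<epsilon>)"
  shows "separable_space (subtopology mtopology (mtopology closure_of A))"
proof -
  have "\<exists>D. \<forall>n. D n \<subseteq> A \<and> countable (D n) \<and> (\<forall>x\<in>A. \<exists>y\<in>D n. d x y < inverse (real (Suc n)))"
  proof (rule choice, rule allI)
    fix n show "\<exists>D. D \<subseteq> A \<and> countable D \<and> (\<forall>x\<in>A. \<exists>y\<in>D. d x y < inverse (real (Suc n)))"
      by (rule net) simp
  qed
  then obtain D where "\<forall>n. D n \<subseteq> A \<and> countable (D n) \<and>
      (\<forall>x\<in>A. \<exists>y\<in>D n. d x y < inverse (real (Suc n)))" ..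
  then have D: "\<And>n. D n \<subseteq> A" "\<And>n. countable (D n)"
      "\<And>n x. x \<in> A \<Longrightarrow> \<exists>y\<in>D n. d x y < inverse (real (Suc n))"
    by simp_all
  let ?D = "\<Union>n. D n"
  have "A \<subseteq> mtopology closure_of ?D"
  proof
    fix x assume x: "x \<in> A"
    have "\<exists>y\<in>?D. y \<in> mball x r" if r: "r > 0" for r
    proof -
      obtain n where "inverse (real (Suc n)) < r" using reals_Archimedean[OF r] by blast
      moreover obtain y where "y \<in> D n" "d x y < inverse (real (Suc n))" using D(3)[OF x] by blast
      ultimately show ?thesis using D(1)[of n] A x by (intro bexI[of _ y]) auto
    qed
    then show "x \<in> mtopology closure_of ?D" using A x unfolding metric_closure_of by blast
  qed
  then have cl: "mtopology closure_of A \<subseteq> mtopology closure_of ?D"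
    by (rule closure_of_minimal) simp
  have sub: "?D \<subseteq> mtopology closure_of A"
    using D(1) closure_of_subset[of A mtopology] A by auto
  have "subtopology mtopology (mtopology closure_of A) closure_of ?D = mtopology closure_of A"
    unfolding closure_of_subtopology using cl sub by (simp only: Int_absorb1 inf.absorb1)
  moreover have "topspace (subtopology mtopology (mtopology closure_of A)) = mtopology closure_of A"
    by (rule topspace_subtopology_subset) (rule closure_of_subset_topspace)
  moreover have "countable ?D" using D(2) by (intro countable_UN) auto
  ultimately show ?thesis
    using sub unfolding separable_space_def by (intro exI[of _ ?D] conjI) (simp_all only:)
qed

text \<open>The infimum need not be attained, so the comparison uses scales strictly above the norm
  of \<open>g\<close>: each finite one is admissible for \<open>g\<close>, hence for
  \<open>f\<close> by monotonicity of \<open>\<Phi> P\<close>.\<close>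

lemma luxemburg_mono:
  assumes orl: "\<And>P. P \<in> \<PP> \<Longrightarrow> orlicz_function (\<Phi> P)" and le: "\<And>x. \<bar>f x\<bar> \<le> \<bar>g x\<bar>"
  shows "luxemburg \<PP> \<Phi> f \<le> luxemburg \<PP> \<Phi> g"
proof (rule dense_ge)
  fix y assume y: "luxemburg \<PP> \<Phi> g < y"
  show "luxemburg \<PP> \<Phi> f \<le> y"
  proof (cases y)
    case (real l)
    note l = luxemburg_lessD[OF orl y[unfolded real(2)]]
    have "luxemburg \<PP> \<Phi> f \<le> ennreal l"
    proof (rule luxemburg_le[OF l(1)])
      fix P assume P: "P \<in> \<PP>"
      have mono: "mono_on {0..} (\<Phi> P)" using orl[OF P] by (simp add: orlicz_function_def)
      have "(\<integral>\<^sup>+x. \<Phi> P (\<bar>f x\<bar> / l) \<partial>P) \<le> (\<integral>\<^sup>+x. \<Phi> P (\<bar>g x\<bar> / l) \<partial>P)"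
        by (intro nn_integral_mono mono_onD[OF mono] divide_right_mono le) (use l in auto)
      also have "\<dots> \<le> 1" using l(2) P by blast
      finally show "(\<integral>\<^sup>+x. \<Phi> P (\<bar>f x\<bar> / l) \<partial>P) \<le> 1" .
    qed
    then show ?thesis using real by simp
  qed simp
qed

text \<open>Multiplying function and scale by \<open>c\<close> leaves the integrand unchanged.
  Strictness in the hypothesis makes \<open>l\<close> itself an admissible scale.\<close>

lemma luxemburg_cmult_less:
  assumes orl: "\<And>P. P \<in> \<PP> \<Longrightarrow> orlicz_function (\<Phi> P)"
    and c: "c > 0" and less: "luxemburg \<PP> \<Phi> f < ennreal l"
  shows "luxemburg \<PP> \<Phi> (\<lambda>x. c * f x) \<le> ennreal (c * l)"
proof (rule luxemburg_le)
  note l = luxemburg_lessD[OF orl less]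
  show "c * l > 0" using c l(1) by simp
  fix P assume "P \<in> \<PP>"
  then show "(\<integral>\<^sup>+x. \<Phi> P (\<bar>c * f x\<bar> / (c * l)) \<partial>P) \<le> 1"
    using l(2) c by (simp add: abs_mult)
qed

theorem proposition5p1:
  fixes \<PP> :: "'a::topological_space measure set"
    and \<Phi> :: "'a measure \<Rightarrow> real \<Rightarrow> ennreal"
    and H :: "('a \<Rightarrow> real) set"
    and C :: "('a \<Rightarrow> real) set set"
  assumes "metrizable_space (euclidean :: 'a topology)"
    and "separable_space (euclidean :: 'a topology)"
    and "\<PP> \<noteq> {}"
    and "\<And>P. P \<in> \<PP> \<Longrightarrow> prob_space P"
    and "\<And>P. P \<in> \<PP> \<Longrightarrow> sets P = sets borel"
    and "\<And>P. P \<in> \<PP> \<Longrightarrow> orlicz_function (\<Phi> P)"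
    and "Linf \<PP> \<subseteq> LPhi \<PP> \<Phi>"
    and "H \<subseteq> bcontfun"
    and "vector_lattice H"
    and "(\<lambda>x. 1) \<in> H"
    and "generating \<PP> H"
    and "C = LPhi_topology \<PP> \<Phi> closure_of (qs_class \<PP> ` H)"
    and "\<And>\<epsilon>::real. \<epsilon> > 0 \<Longrightarrow>
           \<exists>K. compact K \<and> LPhi_norm \<PP> \<Phi> (qs_class \<PP> (indicator (UNIV - K))) < ennreal \<epsilon>"
  shows "separable_space (subtopology (LPhi_topology \<PP> \<Phi>) C)"
proof -
  note orl = assms(6) and sets = assms(5)
  have sc: "second_countable (euclidean :: 'a topology)"
    by (rule separable_metrizable_imp_second_countable[OF assms(1,2)])
  interpret Metric_space "LPhi \<PP> \<Phi>" "LPhi_dist \<PP> \<Phi>"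
    by (rule Metric_space_LPhi[OF orl sets])
  have cont: "continuous_on UNIV f" and bdd: "bounded (range f)" if "f \<in> H" for f
    using that assms(8) by (auto simp: bcontfun_def)
  have meas: "f \<in> borel_measurable borel" if "f \<in> H" for f
    using cont[OF that] by (rule borel_measurable_continuous_onI)
  have A: "qs_class \<PP> ` H \<subseteq> LPhi \<PP> \<Phi>"
    using assms(7) meas bdd unfolding Linf_def by blast
  have "luxemburg \<PP> \<Phi> (\<lambda>x. 1) < \<infinity>"
    using A assms(10) LPhi_norm_class[OF meas[OF assms(10)], of \<PP> \<Phi>] unfolding LPhi_def by auto
  then obtain a where a: "a \<ge> 0" "luxemburg \<PP> \<Phi> (\<lambda>x. 1) = ennreal a"
    by (auto simp: less_top_ennreal)
  \<comment> \<open>The margin 1 gives a bound strictly above the norm of the constant 1, as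
    \<open>luxemburg_cmult_less\<close> requires.\<close>
  define b where "b = a + 1"
  have b: "luxemburg \<PP> \<Phi> (\<lambda>x. 1) < ennreal b"
    using a by (simp add: b_def ennreal_less_iff)
  have "separable_space (subtopology mtopology (mtopology closure_of (qs_class \<PP> ` H)))"
  proof (rule separable_space_closure_of[OF A])
    fix \<epsilon> :: real assume \<epsilon>: "\<epsilon> > 0"
    have b0: "b > 0" using luxemburg_lessD(1)[OF orl b] .
    \<comment> \<open>The error on \<open>K\<close> will cost
      \<open>\<delta> * b = \<epsilon> / 3\<close>. The error off \<open>K\<close> will cost another
      third, leaving room for a strict inequality.\<close>
    define \<delta> where "\<delta> = \<epsilon> / (3 * b)"
    have \<delta>: "\<delta> > 0" using \<epsilon> b0 by (simp add: \<delta>_def)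
    define B where "B n = {f \<in> H. \<forall>x. \<bar>f x\<bar> \<le> real (Suc n)}" for n
    have "\<exists>D\<subseteq>B n. countable D \<and>
        (\<forall>f\<in>B n. \<exists>g\<in>D. LPhi_dist \<PP> \<Phi> (qs_class \<PP> f) (qs_class \<PP> g) < \<epsilon>)" for n
    proof -
      \<comment> \<open>\<open>N\<close> bounds the difference of two members of \<open>B n\<close>,
        hence the error off \<open>K\<close>. It is fixed before \<open>K\<close>, whose complement
        must have norm below \<open>\<epsilon> / (3 * N)\<close>.\<close>
      define N where "N = 2 * real (Suc n)"
      have N: "N > 0" by (simp add: N_def)
      obtain K where K: "compact K"
          "LPhi_norm \<PP> \<Phi> (qs_class \<PP> (indicator (UNIV - K))) < ennreal (\<epsilon> / (3 * N))"
        using assms(13)[of "\<epsilon> / (3 * N)"] \<epsilon> N by auto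
      \<comment> \<open>Compact sets are closed in a Hausdorff space; this makes the indicator
        Borel, so the norm of its class can be computed from the indicator itself.\<close>
      have "closed K"
        using compactin_imp_closedin[OF metrizable_imp_Hausdorff_space[OF assms(1)]] K(1) by simp
      then have [measurable]: "K \<in> sets borel" by simp
      have "(indicator (UNIV - K) :: 'a \<Rightarrow> real) \<in> borel_measurable borel" by measurable
      from LPhi_norm_class[OF this, of \<PP> \<Phi>] K(2)
      have K': "luxemburg \<PP> \<Phi> (indicator (UNIV - K)) < ennreal (\<epsilon> / (3 * N))" by simp
      obtain D where D: "D \<subseteq> B n" "countable D"
          "\<And>f. f \<in> B n \<Longrightarrow> \<exists>g\<in>D. \<forall>x\<in>K. dist (f x) (g x) < \<delta>"
        by (rule countable_uniform_net[OF sc K(1) _ \<delta>, of "B n"])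
          (auto simp: B_def intro: continuous_on_subset[OF cont])
      have "\<exists>g\<in>D. LPhi_dist \<PP> \<Phi> (qs_class \<PP> f) (qs_class \<PP> g) < \<epsilon>" if f: "f \<in> B n" for f
      proof -
        obtain g where g: "g \<in> D" "\<And>x. x \<in> K \<Longrightarrow> dist (f x) (g x) < \<delta>" using D(3)[OF f] by blast
        \<comment> \<open>The net was chosen within \<open>B n\<close>, so \<open>g\<close> obeys
          the same bound as \<open>f\<close> off \<open>K\<close>, where the uniform estimate says
          nothing.\<close>
        have gB: "g \<in> B n" using g D(1) by blast
        have pt: "\<bar>f x - g x\<bar> \<le> \<bar>\<delta> * 1 + N * indicator (UNIV - K) x\<bar>" for x
        proof (cases "x \<in> K")
          case True
          then show ?thesis using g(2)[of x] by (simp add: dist_real_def)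
        next
          case False
          have "\<bar>f x\<bar> \<le> real (Suc n)" "\<bar>g x\<bar> \<le> real (Suc n)" using f gB unfolding B_def by blast+
          then show ?thesis using False \<delta> unfolding N_def by simp
        qed
        have "luxemburg \<PP> \<Phi> (\<lambda>x. f x - g x)
            \<le> luxemburg \<PP> \<Phi> (\<lambda>x. \<delta> * 1 + N * indicator (UNIV - K) x)"
          by (rule luxemburg_mono[OF orl pt])
        also have "\<dots> \<le> luxemburg \<PP> \<Phi> (\<lambda>x. \<delta> * 1) + luxemburg \<PP> \<Phi> (\<lambda>x. N * indicator (UNIV - K) x)"
          by (rule luxemburg_triangle[OF orl sets]) measurable
        also have "\<dots> \<le> ennreal (\<delta> * b) + ennreal (N * (\<epsilon> / (3 * N)))"
          by (intro add_mono luxemburg_cmult_less orl \<delta> N b K')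
        also have "\<dots> = ennreal (2 * \<epsilon> / 3)"
          using \<epsilon> b0 N by (simp add: \<delta>_def flip: ennreal_plus)
        finally have "enn2real (luxemburg \<PP> \<Phi> (\<lambda>x. f x - g x)) \<le> 2 * \<epsilon> / 3"
          using \<epsilon> by (intro enn2real_leI) auto
        moreover have "LPhi_dist \<PP> \<Phi> (qs_class \<PP> f) (qs_class \<PP> g)
            = enn2real (luxemburg \<PP> \<Phi> (\<lambda>x. f x - g x))"
          using f gB by (intro LPhi_dist_class meas) (auto simp: B_def)
        ultimately have "LPhi_dist \<PP> \<Phi> (qs_class \<PP> f) (qs_class \<PP> g) < \<epsilon>" using \<epsilon> by simp
        then show ?thesis using g(1) by blast
      qed
      then show ?thesis using D(1,2) by blast
    qed
    then obtain D where D: "\<And>n. D n \<subseteq> B n" "\<And>n. countable (D n)"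
        "\<And>n f. f \<in> B n \<Longrightarrow> \<exists>g\<in>D n. LPhi_dist \<PP> \<Phi> (qs_class \<PP> f) (qs_class \<PP> g) < \<epsilon>"
      by metis
    show "\<exists>D'\<subseteq>qs_class \<PP> ` H. countable D' \<and> (\<forall>X\<in>qs_class \<PP> ` H. \<exists>Y\<in>D'. LPhi_dist \<PP> \<Phi> X Y < \<epsilon>)"
    proof (intro exI conjI ballI)
      show "qs_class \<PP> ` (\<Union>n. D n) \<subseteq> qs_class \<PP> ` H" using D(1) by (fastforce simp: B_def)
      show "countable (qs_class \<PP> ` (\<Union>n. D n))" using D(2) by auto
      fix X assume "X \<in> qs_class \<PP> ` H"
      then obtain f where f: "f \<in> H" "X = qs_class \<PP> f" by blast
      obtain c where c: "\<And>x. \<bar>f x\<bar> \<le> c" using bdd[OF f(1)] by (auto simp: bounded_iff)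
      obtain n where "c \<le> real n" using real_arch_simple by blast
      then have "\<bar>f x\<bar> \<le> real (Suc n)" for x using c[of x] by simp
      then have "f \<in> B n" using f(1) by (simp add: B_def)
      then obtain g where "g \<in> D n" "LPhi_dist \<PP> \<Phi> (qs_class \<PP> f) (qs_class \<PP> g) < \<epsilon>"
        using D(3) by blast
      then show "\<exists>Y\<in>qs_class \<PP> ` (\<Union>n. D n). LPhi_dist \<PP> \<Phi> X Y < \<epsilon>"
        by (intro bexI[of _ "qs_class \<PP> g"]) (auto simp: f(2))
    qed
  qed
  then show ?thesis by (simp add: assms(12) LPhi_topology_def)
qed

end
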